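(* Let $\mathcal{X}$ be a separable topological space and let $k$ be a bounded, continuous kernel on $\mathcal{X}$. Let $\mathcal{P}(\mathcal{X})$ be the set of Borel probability measures on $\mathcal{X}$ and, for $P\in\mathcal{P}(\mathcal{X})$, let $P_m=m^{-1}\sum_{i=1}^m\delta_{X_i}$, where $X_1,X_2,\dots$ are i.i.d. from $P$. Then for every $\varepsilon>0$, $$\sup_{P\in\mathcal{P}(\mathcal{X})}\mathbb{P}\left(\sup_{m\ge n}\,\sup_{x\in\mathcal{X}}\left|\Phi_kP_m(x)-\Phi_kP(x)\right|>\varepsilon\right)\to 0\quad\text{as } n\to\infty.$$
   Context: A kernel on a set $\mathcal{X}$ is a symmetric function $k\colon\mathcal{X}\times\mathcal{X}\to\mathbb{R}$ that is positive definite, i.e. $\sum_{i,j=1}^{n}a_ia_jk(x_i,x_j)\ge 0$ for all $n$, $a_i\in\mathbb{R}$, $x_i\in\mathcal{X}$; $\mathcal{H}_k$ denotes its reproducing kernel Hilbert space. For a bounded measurable kernel $k$ and a Borel probability measure $Q$ on $\mathcal{X}$, the kernel mean embedding is $\Phi_kQ=\int_{\mathcal{X}}k(\cdot,y)\,dQ(y)\in\mathcal{H}_k$ (Bochner integral), so $\Phi_kQ(x)=\int_{\mathcal{X}}k(x,y)\,dQ(y)$ and $\Phi_kP_m(x)=m^{-1}\sum_{i=1}^mk(x,X_i)$. *)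

theory Defs
  imports "HOL-Probability.Probability"
begin

definition is_kernel :: "('a \<Rightarrow> 'a \<Rightarrow> real) \<Rightarrow> bool" where
  "is_kernel k \<longleftrightarrow> (\<forall>x y. k x y = k y x) \<and>
     (\<forall>(n::nat) (a :: nat \<Rightarrow> real) (x :: nat \<Rightarrow> 'a).
        0 \<le> (\<Sum>i=1..n. \<Sum>j=1..n. a i * a j * k (x i) (x j)))"

(* The reproducing kernel Hilbert space depends on the value k, so it cannot be a type of
   class real_inner; it is a carrier set H of real functions with an inner product ip,
   whose values outside H are irrelevant. *)

definition fnorm :: "(('a \<Rightarrow> real) \<Rightarrow> ('a \<Rightarrow> real) \<Rightarrow> real) \<Rightarrow> ('a \<Rightarrow> real) \<Rightarrow> real" where
  "fnorm ip f = sqrt (ip f f)"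

definition hilbert_function_space ::
    "('a \<Rightarrow> real) set \<Rightarrow> (('a \<Rightarrow> real) \<Rightarrow> ('a \<Rightarrow> real) \<Rightarrow> real) \<Rightarrow> bool" where
  "hilbert_function_space H ip \<longleftrightarrow>
     (\<lambda>x. 0) \<in> H \<and>
     (\<forall>f\<in>H. \<forall>g\<in>H. (\<lambda>x. f x + g x) \<in> H) \<and>
     (\<forall>c. \<forall>f\<in>H. (\<lambda>x. c * f x) \<in> H) \<and>
     (\<forall>f\<in>H. \<forall>g\<in>H. ip f g = ip g f) \<and>
     (\<forall>f\<in>H. \<forall>g\<in>H. \<forall>h\<in>H. ip (\<lambda>x. f x + g x) h = ip f h + ip g h) \<and>
     (\<forall>c. \<forall>f\<in>H. \<forall>g\<in>H. ip (\<lambda>x. c * f x) g = c * ip f g) \<and>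
     (\<forall>f\<in>H. 0 \<le> ip f f) \<and>
     (\<forall>f\<in>H. ip f f = 0 \<longrightarrow> f = (\<lambda>x. 0)) \<and>
     (\<forall>F :: nat \<Rightarrow> 'a \<Rightarrow> real.
        (\<forall>n. F n \<in> H) \<and>
        (\<forall>e>0. \<exists>N. \<forall>m\<ge>N. \<forall>n\<ge>N. fnorm ip (\<lambda>x. F m x - F n x) < e) \<longrightarrow>
        (\<exists>f\<in>H. (\<lambda>n. fnorm ip (\<lambda>x. F n x - f x)) \<longlonglongrightarrow> 0))"

definition is_rkhs ::
    "('a \<Rightarrow> 'a \<Rightarrow> real) \<Rightarrow> ('a \<Rightarrow> real) set \<Rightarrow> (('a \<Rightarrow> real) \<Rightarrow> ('a \<Rightarrow> real) \<Rightarrow> real) \<Rightarrow> bool" where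
  "is_rkhs k H ip \<longleftrightarrow>
     hilbert_function_space H ip \<and>
     (\<forall>x. (\<lambda>z. k z x) \<in> H) \<and>
     (\<forall>f\<in>H. \<forall>x. ip f (\<lambda>z. k z x) = f x)"

(* Bochner integration of functions with values in (H, ip), following
   simple_bochner_integrable, simple_bochner_integral and has_bochner_integral of
   HOL-Analysis.  Those require the codomain to be a second countable normed type, which
   (H, ip) is not.  Borel measurability of the integrand is replaced by strong
   measurability: an a.e. limit, in norm, of simple functions. *)

definition simple_integrable_in ::
    "('a \<Rightarrow> real) set \<Rightarrow> 'b measure \<Rightarrow> ('b \<Rightarrow> 'a \<Rightarrow> real) \<Rightarrow> bool" where
  "simple_integrable_in H M s \<longleftrightarrow>
     simple_function M s \<and> s ` space M \<subseteq> H \<and>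
     emeasure M {y \<in> space M. s y \<noteq> (\<lambda>x. 0)} \<noteq> \<infinity>"

definition simple_integral_in :: "'b measure \<Rightarrow> ('b \<Rightarrow> 'a \<Rightarrow> real) \<Rightarrow> 'a \<Rightarrow> real" where
  "simple_integral_in M s = (\<lambda>x. \<Sum>v\<in>s ` space M. measure M {y \<in> space M. s y = v} * v x)"

definition has_bochner_integral_in ::
    "('a \<Rightarrow> real) set \<Rightarrow> (('a \<Rightarrow> real) \<Rightarrow> ('a \<Rightarrow> real) \<Rightarrow> real) \<Rightarrow>
     'b measure \<Rightarrow> ('b \<Rightarrow> 'a \<Rightarrow> real) \<Rightarrow> ('a \<Rightarrow> real) \<Rightarrow> bool" where
  "has_bochner_integral_in H ip M f v \<longleftrightarrow>
     v \<in> H \<and> (\<forall>y\<in>space M. f y \<in> H) \<and>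
     (\<exists>s :: nat \<Rightarrow> 'b \<Rightarrow> 'a \<Rightarrow> real.
        (\<forall>i. simple_integrable_in H M (s i)) \<and>
        (AE y in M. (\<lambda>i. fnorm ip (\<lambda>x. f y x - s i y x)) \<longlonglongrightarrow> 0) \<and>
        (\<lambda>i. \<integral>\<^sup>+ y. ennreal (fnorm ip (\<lambda>x. f y x - s i y x)) \<partial>M) \<longlonglongrightarrow> 0 \<and>
        (\<lambda>i. fnorm ip (\<lambda>x. simple_integral_in M (s i) x - v x)) \<longlonglongrightarrow> 0)"

definition mean_embedding ::
    "('a \<Rightarrow> real) set \<Rightarrow> (('a \<Rightarrow> real) \<Rightarrow> ('a \<Rightarrow> real) \<Rightarrow> real) \<Rightarrow>
     ('a \<Rightarrow> 'a \<Rightarrow> real) \<Rightarrow> 'a measure \<Rightarrow> 'a \<Rightarrow> real" where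
  "mean_embedding H ip k Q = (THE v. has_bochner_integral_in H ip Q (\<lambda>y. (\<lambda>x. k x y)) v)"

definition borel_probs :: "'a::topological_space measure set" where
  "borel_probs = {P. prob_space P \<and> sets P = sets borel}"

definition empirical_measure :: "nat \<Rightarrow> (nat \<Rightarrow> 'a::topological_space) \<Rightarrow> 'a measure" where
  "empirical_measure m x =
     measure_of UNIV (sets borel)
       (\<lambda>A. (\<Sum>i=1..m. emeasure (return borel (x i)) A) / of_nat m)"

definition iid_sample ::
    "'a::topological_space measure \<Rightarrow> 'w measure \<Rightarrow> (nat \<Rightarrow> 'w \<Rightarrow> 'a) \<Rightarrow> bool" where
  "iid_sample P \<Omega> X \<longleftrightarrow>
     prob_space \<Omega> \<and>
     prob_space.indep_vars \<Omega> (\<lambda>_. borel) X {1..} \<and>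
     (\<forall>i\<ge>1. distr \<Omega> borel (X i) = P)"

end

(* By the reproducing property, sup_x |Phi P_m x - Phi P x| is at most sqrt B times the RKHS norm
   of (1/m) S_m, where S_m is the sum over i <= m of k(., X_i) - Phi P.  These summands are centred,
   independent and bounded, so E ||S_m||^2 <= 4 B m with a constant not depending on P.  Markov's
   inequality at the squares m = j^2 gives a summable tail in j, and between consecutive squares S_m
   changes by at most 4 B j pointwise. *)

theory Submission
  imports Defs "HOL-Library.Discrete_Functions"
begin

text \<open>The second moment alone gives a tail of order \<open>1/m\<close> at sample size
  \<open>m\<close>, which is not summable; restricting to \<open>m = j^2\<close> turns it into
  \<open>1/j^2\<close>. The mean embedding is a definite description, so it carries information only
  once a Bochner integral is known to exist and to be unique. Existence rests on separability: the
  feature map sending \<open>y\<close> to \<open>\<lambda>x. k x y\<close> is continuous, so its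
  range in \<open>H\<close> is separable, and nearest points of a countable dense set give simple
  approximants. The same approximation makes \<open>k\<close> measurable for the product of Borel
  algebras, which Fubini requires. The squared norm is expanded into a double sum of one real
  function of pairs of sample points, so only the joint laws of two real-space observations enter.
  The bad event involves a supremum over an arbitrary space. It is enclosed in a countable union of
  events about squared norms, whose measurability is clear.\<close>

section \<open>Inner-product geometry of a Hilbert space of functions\<close>

locale hilbert_functions =
  fixes H :: "('a \<Rightarrow> real) set" and ip :: "('a \<Rightarrow> real) \<Rightarrow> ('a \<Rightarrow> real) \<Rightarrow> real"
  assumes hilbert_function_space: "hilbert_function_space H ip"
begin

lemma zero_mem: "(\<lambda>x. 0) \<in> H"
  and add_mem: "f \<in> H \<Longrightarrow> g \<in> H \<Longrightarrow> (\<lambda>x. f x + g x) \<in> H"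
  and scale_mem: "f \<in> H \<Longrightarrow> (\<lambda>x. c * f x) \<in> H"
  and ip_commute: "f \<in> H \<Longrightarrow> g \<in> H \<Longrightarrow> ip f g = ip g f"
  and ip_add_left: "f \<in> H \<Longrightarrow> g \<in> H \<Longrightarrow> h \<in> H \<Longrightarrow> ip (\<lambda>x. f x + g x) h = ip f h + ip g h"
  and ip_scale_left: "f \<in> H \<Longrightarrow> g \<in> H \<Longrightarrow> ip (\<lambda>x. c * f x) g = c * ip f g"
  and ip_nonneg: "f \<in> H \<Longrightarrow> 0 \<le> ip f f"
  using hilbert_function_space unfolding hilbert_function_space_def by blast+

lemma complete:
  fixes F :: "nat \<Rightarrow> 'a \<Rightarrow> real"
  assumes "\<And>n. F n \<in> H"
    and "\<And>e. e > 0 \<Longrightarrow> \<exists>N. \<forall>m\<ge>N. \<forall>n\<ge>N. fnorm ip (\<lambda>x. F m x - F n x) < e"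
  shows "\<exists>f\<in>H. (\<lambda>n. fnorm ip (\<lambda>x. F n x - f x)) \<longlonglongrightarrow> 0"
proof -
  have "\<forall>F :: nat \<Rightarrow> 'a \<Rightarrow> real. (\<forall>n. F n \<in> H) \<and>
      (\<forall>e>0. \<exists>N. \<forall>m\<ge>N. \<forall>n\<ge>N. fnorm ip (\<lambda>x. F m x - F n x) < e) \<longrightarrow>
      (\<exists>f\<in>H. (\<lambda>n. fnorm ip (\<lambda>x. F n x - f x)) \<longlonglongrightarrow> 0)"
    using hilbert_function_space unfolding hilbert_function_space_def by (elim conjE)
  then show ?thesis
    using assms by blast
qed

lemma diff_mem: "f \<in> H \<Longrightarrow> g \<in> H \<Longrightarrow> (\<lambda>x. f x - g x) \<in> H"
  using add_mem[of f "\<lambda>x. -1 * g x"] scale_mem[of g "-1"] by simp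

lemma ip_diff_left:
  "f \<in> H \<Longrightarrow> g \<in> H \<Longrightarrow> h \<in> H \<Longrightarrow> ip (\<lambda>x. f x - g x) h = ip f h - ip g h"
  using ip_add_left[of f "\<lambda>x. -1 * g x" h] scale_mem[of g "-1"] ip_scale_left[of g h "-1"] by simp

lemma ip_add_right:
  "f \<in> H \<Longrightarrow> g \<in> H \<Longrightarrow> h \<in> H \<Longrightarrow> ip h (\<lambda>x. f x + g x) = ip h f + ip h g"
  using ip_commute[of h "\<lambda>x. f x + g x"] ip_commute[of h f] ip_commute[of h g]
  by (simp only: add_mem ip_add_left)

lemma ip_diff_right:
  "f \<in> H \<Longrightarrow> g \<in> H \<Longrightarrow> h \<in> H \<Longrightarrow> ip h (\<lambda>x. f x - g x) = ip h f - ip h g"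
  using ip_commute[of h "\<lambda>x. f x - g x"] ip_commute[of h f] ip_commute[of h g]
  by (simp only: diff_mem ip_diff_left)

lemma ip_scale_right: "f \<in> H \<Longrightarrow> g \<in> H \<Longrightarrow> ip g (\<lambda>x. c * f x) = c * ip g f"
  using ip_commute[of g "\<lambda>x. c * f x"] ip_commute[of g f]
  by (simp only: scale_mem ip_scale_left)

lemma ip_zero_left: "g \<in> H \<Longrightarrow> ip (\<lambda>x. 0) g = 0"
  using ip_scale_left[of "\<lambda>x. 0" g 0] zero_mem by simp

lemma sum_mem:
  assumes "\<And>a. a \<in> A \<Longrightarrow> F a \<in> H"
  shows "(\<lambda>x. \<Sum>a\<in>A. c a * F a x) \<in> H"
  using assms
  by (induction A rule: infinite_finite_induct)
    (simp_all add: zero_mem add_mem[OF scale_mem])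

lemma ip_sum_left:
  assumes "\<And>a. a \<in> A \<Longrightarrow> F a \<in> H" "g \<in> H"
  shows "ip (\<lambda>x. \<Sum>a\<in>A. c a * F a x) g = (\<Sum>a\<in>A. c a * ip (F a) g)"
  using assms
proof (induction A rule: infinite_finite_induct)
  case (insert a A)
  then show ?case
    using ip_add_left[of "\<lambda>x. c a * F a x" "\<lambda>x. \<Sum>a\<in>A. c a * F a x" g]
      sum_mem[of A F c] ip_scale_left[of "F a" g "c a"] scale_mem[of "F a" "c a"] by simp
qed (simp_all add: ip_zero_left)

lemma fnorm_nonneg: "f \<in> H \<Longrightarrow> 0 \<le> fnorm ip f"
  by (simp add: fnorm_def ip_nonneg)

lemma fnorm_square: "f \<in> H \<Longrightarrow> (fnorm ip f)\<^sup>2 = ip f f"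
  by (simp add: fnorm_def ip_nonneg)

text \<open>The quadratic \<open>q\<close> in \<open>t\<close> is nonnegative. Evaluating it at its
  minimiser \<open>ip f g / ip g g\<close> gives the claim; if \<open>ip g g = 0\<close> it is
  affine, and an affine function bounded below is constant.\<close>

lemma ip_square_le:
  assumes f: "f \<in> H" and g: "g \<in> H"
  shows "(ip f g)\<^sup>2 \<le> ip f f * ip g g"
proof -
  have q: "0 \<le> ip f f - 2 * t * ip f g + t\<^sup>2 * ip g g" for t
  proof -
    have tg: "(\<lambda>x. t * g x) \<in> H" by (rule scale_mem[OF g])
    have "0 \<le> ip (\<lambda>x. f x - t * g x) (\<lambda>x. f x - t * g x)"
      by (rule ip_nonneg[OF diff_mem[OF f tg]])
    also have "\<dots> = ip f f - ip f (\<lambda>x. t * g x) - (ip (\<lambda>x. t * g x) f - ip (\<lambda>x. t * g x) (\<lambda>x. t * g x))"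
      by (simp only: ip_diff_left ip_diff_right f tg diff_mem)
    also have "\<dots> = ip f f - t * ip f g - (t * ip f g - t * (t * ip g g))"
      by (simp only: ip_scale_left ip_scale_right f g tg ip_commute[OF g f])
    also have "\<dots> = ip f f - 2 * t * ip f g + t\<^sup>2 * ip g g"
      by (simp add: power2_eq_square)
    finally show ?thesis .
  qed
  show ?thesis
  proof (cases "ip g g = 0")
    case True
    have "ip f g = 0"
    proof (rule ccontr)
      assume "ip f g \<noteq> 0"
      \<comment> \<open>This \<open>t\<close> makes the affine function take the value -1.\<close>
      then show False
        using q[of "(ip f f + 1) / (2 * ip f g)"] True by simp
    qed
    then show ?thesis by (simp add: True)
  next
    case False
    then have "0 < ip g g"
      using ip_nonneg[OF g] by simp
    have "0 \<le> ip f f - (ip f g)\<^sup>2 / ip g g"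
      using q[of "ip f g / ip g g"] \<open>0 < ip g g\<close> by (simp add: power2_eq_square)
    then show ?thesis
      using \<open>0 < ip g g\<close> by (simp add: field_simps)
  qed
qed

lemma abs_ip_le:
  assumes "f \<in> H" "g \<in> H"
  shows "\<bar>ip f g\<bar> \<le> fnorm ip f * fnorm ip g"
  using real_sqrt_le_mono[OF ip_square_le[OF assms]] by (simp add: fnorm_def real_sqrt_mult)

lemma fnorm_add_le:
  assumes f: "f \<in> H" and g: "g \<in> H"
  shows "fnorm ip (\<lambda>x. f x + g x) \<le> fnorm ip f + fnorm ip g"
proof (rule power2_le_imp_le)
  have "(fnorm ip (\<lambda>x. f x + g x))\<^sup>2 = ip f f + 2 * ip f g + ip g g"
    using f g by (simp add: fnorm_square add_mem ip_add_left ip_add_right ip_commute[of g f])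
  also have "\<dots> \<le> (fnorm ip f)\<^sup>2 + 2 * (fnorm ip f * fnorm ip g) + (fnorm ip g)\<^sup>2"
    using abs_ip_le[OF f g] by (simp add: fnorm_square f g)
  finally show "(fnorm ip (\<lambda>x. f x + g x))\<^sup>2 \<le> (fnorm ip f + fnorm ip g)\<^sup>2"
    by (simp add: power2_eq_square algebra_simps)
qed (simp add: fnorm_nonneg f g)

lemma fnorm_diff_commute:
  assumes "f \<in> H" "g \<in> H"
  shows "fnorm ip (\<lambda>x. f x - g x) = fnorm ip (\<lambda>x. g x - f x)"
  using assms by (simp add: fnorm_def diff_mem ip_diff_left ip_diff_right)

lemma fnorm_diff_triangle:
  assumes "f \<in> H" "g \<in> H" "h \<in> H"
  shows "fnorm ip (\<lambda>x. f x - h x) \<le> fnorm ip (\<lambda>x. f x - g x) + fnorm ip (\<lambda>x. g x - h x)"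
  using fnorm_add_le[of "\<lambda>x. f x - g x" "\<lambda>x. g x - h x"] assms by (simp add: diff_mem)

section \<open>Pairing Bochner integrals with vectors of \<open>H\<close>\<close>

lemma simple_integral_in_mem:
  assumes "s ` space M \<subseteq> H"
  shows "simple_integral_in M s \<in> H"
  unfolding simple_integral_in_def using assms by (intro sum_mem) auto

lemma ip_simple_integral_in:
  assumes "finite_measure M" and s: "simple_function M s" and sub: "s ` space M \<subseteq> H" and g: "g \<in> H"
  shows "integrable M (\<lambda>y. ip (s y) g)"
    and "ip (simple_integral_in M s) g = (\<integral>y. ip (s y) g \<partial>M)"
proof -
  interpret finite_measure M by fact
  let ?A = "\<lambda>v. {y \<in> space M. s y = v}"
  have fin: "finite (s ` space M)" by (rule simple_functionD(1)[OF s])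
  have A: "?A v \<in> sets M" for v
    using simple_functionD(2)[OF s, of "{v}"] by (simp add: vimage_def Int_def conj_commute)
  have eq: "ip (s y) g = (\<Sum>v\<in>s ` space M. ip v g * indicator (?A v) y)" if "y \<in> space M" for y
  proof -
    have "(\<Sum>v\<in>s ` space M. ip v g * indicator (?A v) y) = (\<Sum>v\<in>s ` space M. if v = s y then ip v g else 0)"
      using that by (intro sum.cong) (auto simp: indicator_def)
    then show ?thesis using that fin by simp
  qed
  have int: "integrable M (\<lambda>y. \<Sum>v\<in>s ` space M. ip v g * indicator (?A v) y)"
    using A by (intro Bochner_Integration.integrable_sum integrable_mult_right) (auto simp: emeasure_eq_measure)
  then show "integrable M (\<lambda>y. ip (s y) g)"
    by (subst Bochner_Integration.integrable_cong[OF refl eq])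
  have "(\<integral>y. ip (s y) g \<partial>M) = (\<integral>y. (\<Sum>v\<in>s ` space M. ip v g * indicator (?A v) y) \<partial>M)"
    by (intro Bochner_Integration.integral_cong refl eq)
  also have "\<dots> = (\<Sum>v\<in>s ` space M. \<integral>y. ip v g * indicator (?A v) y \<partial>M)"
    using A by (intro Bochner_Integration.integral_sum integrable_mult_right) (auto simp: emeasure_eq_measure)
  also have "\<dots> = (\<Sum>v\<in>s ` space M. measure M (?A v) * ip v g)"
    using A by (intro sum.cong) (auto simp: Int_absorb2)
  also have "\<dots> = ip (simple_integral_in M s) g"
    unfolding simple_integral_in_def using sub g by (intro ip_sum_left[symmetric]) auto
  finally show "ip (simple_integral_in M s) g = (\<integral>y. ip (s y) g \<partial>M)" by simp
qed

text \<open>Continuous linear functionals commute with the Bochner integral. This is the only route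
  from the abstract integral to real integrals: it yields uniqueness, the pointwise formula and the
  expectation formula for mean embeddings.\<close>

lemma ip_has_bochner_integral_in:
  assumes M: "finite_measure M" and bi: "has_bochner_integral_in H ip M f v" and g: "g \<in> H"
    and int: "integrable M (\<lambda>y. ip (f y) g)"
  shows "ip v g = (\<integral>y. ip (f y) g \<partial>M)"
proof -
  have v: "v \<in> H" and f: "\<And>y. y \<in> space M \<Longrightarrow> f y \<in> H"
    using bi by (auto simp: has_bochner_integral_in_def)
  obtain s :: "nat \<Rightarrow> 'b \<Rightarrow> 'a \<Rightarrow> real" where
      s: "\<And>i. simple_integrable_in H M (s i)"
      and lim1: "(\<lambda>i. \<integral>\<^sup>+ y. ennreal (fnorm ip (\<lambda>x. f y x - s i y x)) \<partial>M) \<longlonglongrightarrow> 0"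
      and lim2: "(\<lambda>i. fnorm ip (\<lambda>x. simple_integral_in M (s i) x - v x)) \<longlonglongrightarrow> 0"
    using bi unfolding has_bochner_integral_in_def by blast
  have ss: "simple_function M (s i)" "s i ` space M \<subseteq> H" for i
    using s by (auto simp: simple_integrable_in_def)
  note I = simple_integral_in_mem[OF ss(2)]
  text \<open>The approximants are only a.e. close to \<open>f\<close>, so \<open>fnorm\<close> of the difference need not be
    measurable; normalising the test function avoids pulling a constant out of that integral.\<close>
  have *: "ip v h = (\<integral>y. ip (f y) h \<partial>M)"
    if h: "h \<in> H" and h1: "fnorm ip h \<le> 1" and int: "integrable M (\<lambda>y. ip (f y) h)" for h
  proof -
    note [simp] = ip_simple_integral_in(1)[OF M ss h]
    have bound: "\<bar>ip a h\<bar> \<le> fnorm ip a" if "a \<in> H" for a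
      using abs_ip_le[OF that h] mult_left_mono[OF h1 fnorm_nonneg[OF that]] by simp
    have "ennreal \<bar>(\<integral>y. ip (f y) h \<partial>M) - ip (simple_integral_in M (s i)) h\<bar> \<le>
        (\<integral>\<^sup>+ y. ennreal (fnorm ip (\<lambda>x. f y x - s i y x)) \<partial>M)" for i
    proof -
      have "(\<integral>y. ip (f y) h \<partial>M) - ip (simple_integral_in M (s i)) h = (\<integral>y. ip (f y) h - ip (s i y) h \<partial>M)"
        by (simp add: ip_simple_integral_in(2)[OF M ss h] int)
      then have "ennreal \<bar>(\<integral>y. ip (f y) h \<partial>M) - ip (simple_integral_in M (s i)) h\<bar>
          \<le> (\<integral>\<^sup>+ y. ennreal \<bar>ip (f y) h - ip (s i y) h\<bar> \<partial>M)"
        using integral_norm_bound_ennreal[of M "\<lambda>y. ip (f y) h - ip (s i y) h"] int by simp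
      also have "\<dots> \<le> (\<integral>\<^sup>+ y. ennreal (fnorm ip (\<lambda>x. f y x - s i y x)) \<partial>M)"
      proof (intro nn_integral_mono ennreal_leI)
        fix y assume y: "y \<in> space M"
        have sy: "s i y \<in> H" using ss(2) y by blast
        show "\<bar>ip (f y) h - ip (s i y) h\<bar> \<le> fnorm ip (\<lambda>x. f y x - s i y x)"
          using bound[OF diff_mem[OF f[OF y] sy]] ip_diff_left[OF f[OF y] sy h] by simp
      qed
      finally show ?thesis .
    qed
    then have "(\<lambda>i. ennreal \<bar>(\<integral>y. ip (f y) h \<partial>M) - ip (simple_integral_in M (s i)) h\<bar>) \<longlonglongrightarrow> 0"
      by (intro tendsto_sandwich[OF _ _ tendsto_const lim1]) auto
    then have "(\<lambda>i. \<bar>(\<integral>y. ip (f y) h \<partial>M) - ip (simple_integral_in M (s i)) h\<bar>) \<longlonglongrightarrow> 0"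
      by (subst (asm) ennreal_0[symmetric], subst (asm) tendsto_ennreal_iff) auto
    moreover have "(\<lambda>i. ip (simple_integral_in M (s i)) h - ip v h) \<longlonglongrightarrow> 0"
      by (rule tendsto_rabs_zero_cancel, rule tendsto_sandwich[OF _ _ tendsto_const lim2])
        (auto simp: ip_diff_left[symmetric] I v h intro!: always_eventually bound diff_mem)
    ultimately have "(\<lambda>i. ((\<integral>y. ip (f y) h \<partial>M) - ip (simple_integral_in M (s i)) h)
        + (ip (simple_integral_in M (s i)) h - ip v h)) \<longlonglongrightarrow> 0 + 0"
      by (intro tendsto_add) (simp_all add: tendsto_rabs_zero_iff)
    then have "(\<lambda>i::nat. (\<integral>y. ip (f y) h \<partial>M) - ip v h) \<longlonglongrightarrow> 0" by simp
    then show ?thesis by (simp add: LIMSEQ_const_iff)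
  qed
  \<comment> \<open>The summand 1 keeps the scaling factor meaningful when \<open>g\<close> has norm
    0.\<close>
  define c where "c = inverse (1 + fnorm ip g)"
  have c: "c > 0" "c * fnorm ip g \<le> 1"
    using fnorm_nonneg[OF g] by (auto simp: c_def field_simps)
  have eq: "ip (f y) (\<lambda>x. c * g x) = c * ip (f y) g" if "y \<in> space M" for y
    by (rule ip_scale_right[OF g f[OF that]])
  have "ip v (\<lambda>x. c * g x) = (\<integral>y. ip (f y) (\<lambda>x. c * g x) \<partial>M)"
  proof (rule *)
    show "fnorm ip (\<lambda>x. c * g x) \<le> 1"
      using c ip_scale_left[OF g scale_mem[OF g]] ip_scale_right[OF g g]
      by (simp add: fnorm_def real_sqrt_mult flip: mult.assoc)
    show "integrable M (\<lambda>y. ip (f y) (\<lambda>x. c * g x))"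
      using int by (subst Bochner_Integration.integrable_cong[OF refl eq]) simp_all
  qed (rule scale_mem[OF g])
  also have "\<dots> = (\<integral>y. c * ip (f y) g \<partial>M)"
    by (intro Bochner_Integration.integral_cong refl eq)
  finally show ?thesis
    using c(1) by (simp add: ip_scale_right[OF g v])
qed

end

section \<open>Empirical measures and pairwise independence\<close>

text \<open>\<open>measure_of\<close> keeps the given set function only if it is a measure.
  Recognising the push-forward of the uniform law on the indices settles this, and integrals become
  finite averages. For \<open>m = 0\<close> there is no uniform law.\<close>

lemma empirical_measure_eq_distr:
  fixes x :: "nat \<Rightarrow> 'a::topological_space"
  assumes "m \<ge> 1"
  shows "empirical_measure m x = distr (uniform_count_measure {1..m}) borel x"
proof -
  let ?N = "distr (uniform_count_measure {1..m}) borel x"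
  have [simp]: "x \<in> uniform_count_measure {1..m} \<rightarrow>\<^sub>M borel"
    by (simp add: measurable_cong_sets[OF sets_uniform_count_measure_count_space refl])
  have eq: "(\<Sum>i=1..m. emeasure (return borel (x i)) A) / of_nat m = emeasure ?N A" if A: "A \<in> sets borel" for A
  proof -
    have "(\<Sum>i=1..m. emeasure (return borel (x i)) A) = (\<Sum>i=1..m. indicator A (x i))"
      using A by simp
    also have "\<dots> = of_nat (card {i \<in> {1..m}. x i \<in> A})"
      by (simp add: indicator_def sum.If_cases Int_def)
    finally have "(\<Sum>i=1..m. emeasure (return borel (x i)) A) / of_nat m =
        ennreal (real (card {i \<in> {1..m}. x i \<in> A}) / real m)"
      using assms by (simp add: divide_ennreal flip: ennreal_of_nat_eq_real_of_nat)
        (simp add: ennreal_of_nat_eq_real_of_nat divide_ennreal)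
    also have "\<dots> = emeasure (uniform_count_measure {1..m}) {i \<in> {1..m}. x i \<in> A}"
      by (subst emeasure_uniform_count_measure) auto
    also have "\<dots> = emeasure ?N A"
      using A by (simp add: emeasure_distr space_uniform_count_measure vimage_def Int_def conj_commute)
    finally show ?thesis .
  qed
  have "sigma_sets UNIV (sets borel) = (sets borel :: 'a set set)"
    using sets.sigma_sets_eq[of "borel :: 'a measure"] by simp
  then have "empirical_measure m x = measure_of UNIV (sets borel) (emeasure ?N)"
    unfolding empirical_measure_def by (intro measure_of_eq eq) simp_all
  also have "\<dots> = ?N"
    using measure_of_of_measure[of ?N] by simp
  finally show ?thesis .
qed

lemma empirical_measure_in_borel_probs:
  assumes "m \<ge> 1"
  shows "empirical_measure m x \<in> borel_probs"
proof -
  have "prob_space (uniform_count_measure {1..m})"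
    using assms by (intro prob_space_uniform_count_measure) auto
  then have "prob_space (distr (uniform_count_measure {1..m}) borel x)"
    by (rule prob_space.prob_space_distr)
      (simp add: measurable_cong_sets[OF sets_uniform_count_measure_count_space refl])
  then show ?thesis
    by (simp add: borel_probs_def empirical_measure_eq_distr[OF assms])
qed

lemma (in prob_space) indep_var_of_indep_vars:
  assumes "indep_vars (\<lambda>_. N) X I" "i \<in> I" "j \<in> I" "i \<noteq> j"
  shows "indep_var N (X i) N (X j)"
proof -
  have "indep_var N ((\<lambda>f. f i) \<circ> (\<lambda>\<omega>. restrict (\<lambda>i. X i \<omega>) {i}))
      N ((\<lambda>f. f j) \<circ> (\<lambda>\<omega>. restrict (\<lambda>i. X i \<omega>) {j}))"
    using assms by (intro indep_var_compose[OF indep_var_restrict[OF assms(1)]]) auto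
  then show ?thesis by (simp add: comp_def)
qed

section \<open>The kernel pseudometric and the regularity of functions in \<open>H\<close>\<close>

locale bounded_continuous_rkhs = hilbert_functions H ip
  for H :: "('a::topological_space \<Rightarrow> real) set" and ip +
  fixes k :: "'a \<Rightarrow> 'a \<Rightarrow> real" and B :: real
  assumes kernel_mem: "(\<lambda>x. k x y) \<in> H"
    and reproducing: "f \<in> H \<Longrightarrow> ip f (\<lambda>x. k x y) = f y"
    and abs_kernel_le: "\<bar>k x y\<bar> \<le> B"
    and continuous_kernel: "continuous_on UNIV (\<lambda>(x, y). k x y)"
    and separable: "separable_space (euclidean :: 'a topology)"
begin

lemma kernel_commute: "k x y = k y x"
  using reproducing[OF kernel_mem, of x y] reproducing[OF kernel_mem, of y x]
    ip_commute[OF kernel_mem kernel_mem, of x y] by simp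

lemma bound_nonneg: "0 \<le> B"
  using abs_kernel_le[of undefined undefined] by simp

lemma fnorm_kernel_le: "fnorm ip (\<lambda>x. k x y) \<le> sqrt B"
  using abs_kernel_le[of y y] by (simp add: fnorm_def reproducing kernel_mem)

lemma abs_mem_le:
  assumes "g \<in> H"
  shows "\<bar>g y\<bar> \<le> fnorm ip g * sqrt B"
proof -
  have "\<bar>g y\<bar> \<le> fnorm ip g * fnorm ip (\<lambda>x. k x y)"
    using abs_ip_le[OF assms kernel_mem, of y] by (simp add: reproducing assms)
  also have "\<dots> \<le> fnorm ip g * sqrt B"
    by (intro mult_left_mono fnorm_kernel_le fnorm_nonneg assms)
  finally show ?thesis .
qed

text \<open>The pseudometric pulled back from \<open>H\<close> along the feature map. Distinct
  points may be at distance 0, and the given topology is only finer than the one it induces.\<close>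

definition kdist :: "'a \<Rightarrow> 'a \<Rightarrow> real" where
  "kdist y z = fnorm ip (\<lambda>x. k x y - k x z)"

lemma kdist_eq: "kdist y z = sqrt (k y y - 2 * k y z + k z z)"
  unfolding kdist_def fnorm_def
  by (simp add: ip_diff_left ip_diff_right kernel_mem diff_mem reproducing kernel_commute[of z y])

lemma kdist_nonneg: "0 \<le> kdist y z"
  unfolding kdist_def by (intro fnorm_nonneg diff_mem kernel_mem)

lemma kdist_le: "kdist y z \<le> sqrt (4 * B)"
  unfolding kdist_eq
  using abs_kernel_le[of y y] abs_kernel_le[of y z] abs_kernel_le[of z z]
  by (intro real_sqrt_le_mono) linarith

lemma kdist_self: "kdist y y = 0"
  by (simp add: kdist_eq)

lemma continuous_on_kernel:
  assumes "continuous_on UNIV f" "continuous_on UNIV g"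
  shows "continuous_on UNIV (\<lambda>y. k (f y) (g y))"
  using continuous_on_compose2[OF continuous_kernel continuous_on_Pair[OF assms]] by simp

lemma continuous_on_kdist: "continuous_on UNIV (\<lambda>y. kdist y z)"
  unfolding kdist_eq by (intro continuous_intros continuous_on_kernel)

lemma abs_diff_le_kdist:
  assumes "g \<in> H"
  shows "\<bar>g y - g z\<bar> \<le> fnorm ip g * kdist y z"
  using abs_ip_le[OF assms diff_mem[OF kernel_mem kernel_mem], of y z]
  by (simp add: assms ip_diff_right kernel_mem reproducing kdist_def)

text \<open>By Cauchy-Schwarz every member of \<open>H\<close> is Lipschitz for
  \<open>kdist\<close>, and \<open>kdist y z\<close> tends to 0 as \<open>y\<close> tends to
  \<open>z\<close>.\<close>

lemma continuous_on_mem: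
  assumes g: "g \<in> H"
  shows "continuous_on UNIV g"
proof -
  have "(g \<longlongrightarrow> g z) (at z)" for z
  proof -
    have "((\<lambda>y. kdist y z) \<longlongrightarrow> kdist z z) (at z)"
      using continuous_on_kdist[of z] by (simp add: continuous_on_def)
    then have "((\<lambda>y. fnorm ip g * kdist y z) \<longlongrightarrow> 0) (at z)"
      unfolding kdist_self by (rule tendsto_mult_right_zero)
    then have "((\<lambda>y. g y - g z) \<longlongrightarrow> 0) (at z)"
      by (rule Lim_null_comparison[OF always_eventually, rotated])
        (simp add: abs_diff_le_kdist[OF g])
    then show ?thesis by (rule LIM_zero_cancel)
  qed
  then show ?thesis by (simp add: continuous_on_def)
qed

lemma borel_measurable_mem [measurable]: "g \<in> H \<Longrightarrow> g \<in> borel_measurable borel"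
  by (intro borel_measurable_continuous_onI continuous_on_mem)

lemma borel_measurable_kernel [measurable]: "(\<lambda>y. k x y) \<in> borel_measurable borel"
  by (intro borel_measurable_continuous_onI continuous_on_kernel continuous_intros)

lemma borel_measurable_kdist [measurable]: "(\<lambda>y. kdist y z) \<in> borel_measurable borel"
  by (intro borel_measurable_continuous_onI continuous_on_kdist)

section \<open>Separability and nearest-centre approximation\<close>

text \<open>Balls of \<open>kdist\<close> are open in the original topology, so a topologically
  dense set meets each of them.\<close>

lemma ex_dense_sequence: "\<exists>d :: nat \<Rightarrow> 'a. \<forall>y. \<forall>e>0. \<exists>j. kdist y (d j) < e"
proof -
  obtain C :: "'a set" where C: "countable C" "closure C = UNIV"
    using separable by (auto simp: separable_space_def)
  have "C \<noteq> {}" using C(2) by auto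
  have "\<exists>j. kdist y (from_nat_into C j) < e" if "e > 0" for y e
  proof -
    have "open {z. kdist z y < e}"
      by (intro open_Collect_less continuous_on_kdist continuous_on_const)
    moreover have "y \<in> {z. kdist z y < e}" using that by (simp add: kdist_self)
    ultimately have "{z. kdist z y < e} \<inter> C \<noteq> {}"
      using C(2) by (metis UNIV_I disjoint_iff open_Int_closure_eq_empty)
    then obtain c where "c \<in> C" "kdist c y < e" by auto
    moreover have "kdist y c = kdist c y" by (simp add: kdist_eq kernel_commute[of c y])
    ultimately show ?thesis
      using from_nat_into_surj[OF C(1)] by metis
  qed
  then show ?thesis by (intro exI[of _ "from_nat_into C"]) blast
qed

definition centre :: "nat \<Rightarrow> 'a" where
  "centre = (SOME d. \<forall>y. \<forall>e>0. \<exists>j. kdist y (d j) < e)"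

lemma ex_centre: "e > 0 \<Longrightarrow> \<exists>j. kdist y (centre j) < e"
  using someI_ex[OF ex_dense_sequence] unfolding centre_def by blast

text \<open>Index of a closest point among the first \<open>i + 1\<close> centres, ties going to the
  smaller index. Returning an index rather than a point gives finitely many values in a countable
  type, so that measurability and simplicity can be checked without any structure on the
  space.\<close>

primrec nearest :: "nat \<Rightarrow> 'a \<Rightarrow> nat" where
  "nearest 0 y = 0"
| "nearest (Suc i) y =
    (if kdist y (centre (Suc i)) < kdist y (centre (nearest i y)) then Suc i else nearest i y)"

lemma nearest_le: "nearest i y \<le> i"
  by (induction i) auto

lemma kdist_nearest_le: "j \<le> i \<Longrightarrow> kdist y (centre (nearest i y)) \<le> kdist y (centre j)"
proof (induction i)
  case (Suc i)
  then show ?case by (cases "j = Suc i") fastforce+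
qed simp

text \<open>The recursion tests the distance to a centre whose index itself depends on
  \<open>y\<close>; as that index is countably valued, it suffices to treat each centre
  separately.\<close>

lemma measurable_nearest [measurable]: "nearest i \<in> borel \<rightarrow>\<^sub>M count_space UNIV"
proof (induction i)
  case (Suc i)
  note [measurable] = Suc
  have [measurable]: "(\<lambda>y. kdist y (centre (nearest i y))) \<in> borel_measurable borel"
    by (rule measurable_compose_countable[OF _ Suc]) measurable
  show ?case by simp
qed simp

lemma borel_measurable_kdist_nearest [measurable]:
  "(\<lambda>y. kdist y (centre (nearest i y))) \<in> borel_measurable borel"
  by (rule measurable_compose_countable[OF _ measurable_nearest]) measurable

lemma kdist_nearest_tendsto: "(\<lambda>i. kdist y (centre (nearest i y))) \<longlonglongrightarrow> 0"
proof (rule LIMSEQ_I)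
  fix e :: real assume "e > 0"
  then obtain j where j: "kdist y (centre j) < e" using ex_centre by blast
  have "norm (kdist y (centre (nearest i y)) - 0) < e" if "i \<ge> j" for i
    using kdist_nearest_le[OF that, of y] j kdist_nonneg[of y] by simp
  then show "\<exists>j. \<forall>i\<ge>j. norm (kdist y (centre (nearest i y)) - 0) < e" by blast
qed

text \<open>Joint continuity does not give measurability for the product \<open>\<sigma>\<close>-algebra, since
  the space need not be second countable; approximating the first argument does.\<close>

lemma borel_measurable_kernel_pair [measurable]:
  "(\<lambda>(y, z). k y z) \<in> borel_measurable (borel \<Otimes>\<^sub>M borel)"
proof (rule borel_measurable_LIMSEQ_real)
  show "(\<lambda>p. k (centre (nearest i (fst p))) (snd p)) \<in> borel_measurable (borel \<Otimes>\<^sub>M borel)" for i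
    by (rule measurable_compose_countable[where f = "\<lambda>j p. k (centre j) (snd p)"]) measurable
  show "(\<lambda>i. k (centre (nearest i (fst p))) (snd p)) \<longlonglongrightarrow> (\<lambda>(y, z). k y z) p" for p
  proof (cases p)
    case (Pair y z)
    have "\<bar>k (centre (nearest i y)) z - k y z\<bar> \<le> fnorm ip (\<lambda>x. k x z) * kdist y (centre (nearest i y))" for i
      using abs_diff_le_kdist[OF kernel_mem[of z], of y "centre (nearest i y)"]
      by (simp add: abs_minus_commute)
    moreover have "(\<lambda>i. fnorm ip (\<lambda>x. k x z) * kdist y (centre (nearest i y))) \<longlonglongrightarrow> fnorm ip (\<lambda>x. k x z) * 0"
      by (intro tendsto_intros kdist_nearest_tendsto)
    ultimately have "(\<lambda>i. k (centre (nearest i y)) z - k y z) \<longlonglongrightarrow> 0"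
      using Lim_null_comparison[OF always_eventually, of "\<lambda>i. k (centre (nearest i y)) z - k y z"
          "\<lambda>i. fnorm ip (\<lambda>x. k x z) * kdist y (centre (nearest i y))"]
      by simp
    then show ?thesis by (simp add: Pair LIM_zero_iff)
  qed
qed

section \<open>Existence and uniqueness of mean embeddings\<close>

lemma integrable_mem:
  assumes P: "P \<in> borel_probs" and g: "g \<in> H"
  shows "integrable P g"
proof -
  interpret prob_space P using P by (simp add: borel_probs_def)
  have [measurable_cong]: "sets P = sets borel" using P by (simp add: borel_probs_def)
  show ?thesis
    using borel_measurable_mem[OF g] by (intro integrable_const_bound[of _ "fnorm ip g * sqrt B"])
      (auto simp: abs_mem_le[OF g] measurable_cong_sets[OF \<open>sets P = sets borel\<close> refl])
qed

text \<open>Replacing \<open>y\<close> by its nearest centre gives simple functions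
  \<open>s i\<close> with error \<open>D i\<close>. The errors are bounded and vanish pointwise, so
  their means \<open>a i\<close> vanish by dominated convergence; the simple integrals are then
  Cauchy and completeness supplies the value.\<close>

lemma has_bochner_integral_in_kernel:
  assumes P: "P \<in> borel_probs"
  shows "\<exists>v. has_bochner_integral_in H ip P (\<lambda>y x. k x y) v"
proof -
  interpret prob_space P using P by (simp add: borel_probs_def)
  have sets_P [measurable_cong]: "sets P = sets borel" using P by (simp add: borel_probs_def)
  define D where "D i y = kdist y (centre (nearest i y))" for i y
  define s where "s i y = (\<lambda>x. k x (centre (nearest i y)))" for i y
  have [measurable]: "D i \<in> borel_measurable P" for i
    unfolding D_def by measurable
  have D: "0 \<le> D i y" "D i y \<le> sqrt (4 * B)" for i y
    by (auto simp: D_def kdist_nonneg kdist_le)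
  have D_int: "integrable P (D i)" for i
    using D by (intro integrable_const_bound[of _ "sqrt (4 * B)"]) auto
  define a where "a i = (\<integral>y. D i y \<partial>P)" for i
  have "a \<longlonglongrightarrow> (\<integral>y. 0 \<partial>P)"
    unfolding a_def
    by (rule integral_dominated_convergence[where w = "\<lambda>_. sqrt (4 * B)"])
      (use D in \<open>auto simp: D_def kdist_nearest_tendsto\<close>)
  then have a0: "a \<longlonglongrightarrow> 0" by simp
  have s_mem: "s i y \<in> H" for i y
    by (simp add: s_def kernel_mem)
  have "nearest i ` space P \<subseteq> {..i}" for i
    using nearest_le by auto
  then have "finite (nearest i ` space P)" for i
    by (rule finite_subset) simp
  then have "simple_function P (nearest i)" for i
    by (simp add: simple_function_eq_measurable measurable_cong_sets[OF sets_P refl])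
  then have ss: "simple_function P (s i)" for i
    unfolding s_def by (rule simple_function_compose1)
  have sub: "s i ` space P \<subseteq> H" for i
    using s_mem by auto
  let ?I = "\<lambda>i. simple_integral_in P (s i)"
  have I: "?I i \<in> H" for i
    by (rule simple_integral_in_mem[OF sub])
  \<comment> \<open>Testing against the difference \<open>?w\<close> of the two integrals itself
    bounds its squared norm by \<open>(a i + a j) * fnorm ip ?w\<close>; cancelling one factor
    leaves the estimate.\<close>
  have le: "fnorm ip (\<lambda>x. ?I i x - ?I j x) \<le> a i + a j" for i j
  proof -
    let ?w = "\<lambda>x. ?I i x - ?I j x"
    have w: "?w \<in> H" by (intro diff_mem I)
    note si = ip_simple_integral_in[OF finite_measure_axioms ss sub w]
    have "(fnorm ip ?w)\<^sup>2 = ip (?I i) ?w - ip (?I j) ?w"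
      by (simp add: fnorm_square[OF w] ip_diff_left[OF I I w])
    also have "\<dots> = (\<integral>y. ip (s i y) ?w - ip (s j y) ?w \<partial>P)"
      by (simp add: si)
    also have "\<dots> \<le> (\<integral>y. (D i y + D j y) * fnorm ip ?w \<partial>P)"
    proof (intro integral_mono Bochner_Integration.integrable_diff si(1))
      show "integrable P (\<lambda>y. (D i y + D j y) * fnorm ip ?w)"
        by (intro integrable_mult_left Bochner_Integration.integrable_add D_int)
      fix y
      have "ip (s i y) ?w - ip (s j y) ?w = ip (\<lambda>x. s i y x - s j y x) ?w"
        by (simp only: ip_diff_left[OF s_mem s_mem w])
      also have "\<dots> \<le> fnorm ip (\<lambda>x. s i y x - s j y x) * fnorm ip ?w"
        using abs_ip_le[OF diff_mem[OF s_mem s_mem] w, of i y j y] by simp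
      also have "\<dots> \<le> (D i y + D j y) * fnorm ip ?w"
        using fnorm_diff_triangle[OF s_mem kernel_mem s_mem, of i y j y y]
          fnorm_diff_commute[OF s_mem kernel_mem, of i y y]
        by (intro mult_right_mono fnorm_nonneg[OF w]) (simp add: D_def s_def kdist_def)
      finally show "ip (s i y) ?w - ip (s j y) ?w \<le> (D i y + D j y) * fnorm ip ?w" .
    qed
    also have "\<dots> = (a i + a j) * fnorm ip ?w"
      by (simp add: a_def D_int)
    finally have "fnorm ip ?w * fnorm ip ?w \<le> (a i + a j) * fnorm ip ?w"
      by (simp add: power2_eq_square)
    moreover have "0 \<le> a i + a j"
      unfolding a_def by (intro add_nonneg_nonneg integral_nonneg) (simp_all add: D)
    ultimately show ?thesis
      using fnorm_nonneg[OF w] by (cases "fnorm ip ?w = 0") auto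
  qed
  obtain v where v: "v \<in> H" "(\<lambda>i. fnorm ip (\<lambda>x. ?I i x - v x)) \<longlonglongrightarrow> 0"
  proof -
    have "\<exists>N. \<forall>m\<ge>N. \<forall>n\<ge>N. fnorm ip (\<lambda>x. ?I m x - ?I n x) < e" if "e > 0" for e
    proof -
      obtain N where N: "\<And>n. n \<ge> N \<Longrightarrow> norm (a n - 0) < e / 2"
        using LIMSEQ_D[OF a0, of "e / 2"] \<open>e > 0\<close> by auto
      have "fnorm ip (\<lambda>x. ?I m x - ?I n x) < e" if "m \<ge> N" "n \<ge> N" for m n
        using le[of m n] N[OF that(1)] N[OF that(2)] by simp
      then show ?thesis by blast
    qed
    from complete[OF I this] that show thesis by blast
  qed
  have "has_bochner_integral_in H ip P (\<lambda>y x. k x y) v"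
    unfolding has_bochner_integral_in_def
  proof (intro conjI exI[of _ s] allI ballI)
    show "simple_integrable_in H P (s i)" for i
      by (simp add: simple_integrable_in_def ss sub emeasure_eq_measure)
    show "AE y in P. (\<lambda>i. fnorm ip (\<lambda>x. k x y - s i y x)) \<longlonglongrightarrow> 0"
      using kdist_nearest_tendsto by (simp add: s_def kdist_def)
    have "(\<integral>\<^sup>+ y. ennreal (D i y) \<partial>P) = ennreal (a i)" for i
      unfolding a_def by (intro nn_integral_eq_integral D_int) (simp add: D)
    moreover have "D i y = fnorm ip (\<lambda>x. k x y - s i y x)" for i y
      by (simp add: D_def s_def kdist_def)
    ultimately show "(\<lambda>i. \<integral>\<^sup>+ y. ennreal (fnorm ip (\<lambda>x. k x y - s i y x)) \<partial>P) \<longlonglongrightarrow> 0"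
      using tendsto_ennrealI[OF a0] by simp
  qed (use v kernel_mem in auto)
  then show ?thesis by blast
qed

text \<open>Two Bochner integrals have the same pairing with each kernel section, and by the
  reproducing property these pairings are their point values. Hence \<open>THE\<close> denotes the
  integral just constructed.\<close>

lemma has_bochner_integral_in_mean_embedding:
  assumes P: "P \<in> borel_probs"
  shows "has_bochner_integral_in H ip P (\<lambda>y x. k x y) (mean_embedding H ip k P)"
proof -
  interpret prob_space P using P by (simp add: borel_probs_def)
  have "v = w" if v: "has_bochner_integral_in H ip P (\<lambda>y x. k x y) v"
    and w: "has_bochner_integral_in H ip P (\<lambda>y x. k x y) w" for v w
  proof
    fix x
    have int: "integrable P (\<lambda>y. ip (\<lambda>x. k x y) (\<lambda>z. k z x))"
      by (simp add: reproducing kernel_mem kernel_commute[of x] integrable_mem[OF P])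
    have "v \<in> H" "w \<in> H" using v w by (auto simp: has_bochner_integral_in_def)
    then show "v x = w x"
      using ip_has_bochner_integral_in[OF finite_measure_axioms v kernel_mem int]
        ip_has_bochner_integral_in[OF finite_measure_axioms w kernel_mem int]
      by (simp add: reproducing)
  qed
  then show ?thesis
    unfolding mean_embedding_def
    using has_bochner_integral_in_kernel[OF P] by (metis (mono_tags, lifting) theI)
qed

lemma mean_embedding_mem: "P \<in> borel_probs \<Longrightarrow> mean_embedding H ip k P \<in> H"
  using has_bochner_integral_in_mean_embedding by (simp add: has_bochner_integral_in_def)

text \<open>The mean embedding is the Riesz representer of expectation under
  \<open>P\<close>.\<close>

lemma ip_mean_embedding:
  assumes P: "P \<in> borel_probs" and g: "g \<in> H"
  shows "ip (mean_embedding H ip k P) g = (\<integral>y. g y \<partial>P)"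
proof -
  interpret prob_space P using P by (simp add: borel_probs_def)
  have eq: "ip (\<lambda>x. k x y) g = g y" for y
    using ip_commute[OF kernel_mem g] by (simp add: reproducing g)
  show ?thesis
    using ip_has_bochner_integral_in[OF finite_measure_axioms
        has_bochner_integral_in_mean_embedding[OF P] g]
    by (simp add: eq integrable_mem[OF P g])
qed

lemma mean_embedding_eq:
  assumes "P \<in> borel_probs"
  shows "mean_embedding H ip k P x = (\<integral>y. k x y \<partial>P)"
  using ip_mean_embedding[OF assms kernel_mem, of x]
  by (simp add: reproducing mean_embedding_mem assms kernel_commute[of x])

lemma abs_integral_le:
  assumes "P \<in> borel_probs" "g \<in> H" "\<And>y. \<bar>g y\<bar> \<le> c"
  shows "\<bar>\<integral>y. g y \<partial>P\<bar> \<le> c"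
proof -
  interpret prob_space P using assms by (simp add: borel_probs_def)
  have "\<bar>\<integral>y. g y \<partial>P\<bar> \<le> (\<integral>y. \<bar>g y\<bar> \<partial>P)" by (rule integral_abs_bound)
  also have "\<dots> \<le> (\<integral>y. c \<partial>P)"
    using assms(3) integrable_mem[OF assms(1,2)] by (intro integral_mono) auto
  finally show ?thesis by (simp add: prob_space)
qed

lemma abs_mean_embedding_le:
  assumes "P \<in> borel_probs"
  shows "\<bar>mean_embedding H ip k P x\<bar> \<le> B"
  unfolding mean_embedding_eq[OF assms] kernel_commute[of x]
  by (rule abs_integral_le[OF assms kernel_mem abs_kernel_le])

lemma mean_embedding_empirical_measure:
  assumes "m \<ge> 1"
  shows "mean_embedding H ip k (empirical_measure m x) z = (\<Sum>i=1..m. k z (x i)) / m"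
proof -
  have "mean_embedding H ip k (empirical_measure m x) z =
      (\<integral>y. k z y \<partial>distr (uniform_count_measure {1..m}) borel x)"
    by (subst mean_embedding_eq[OF empirical_measure_in_borel_probs[OF assms]])
      (simp only: empirical_measure_eq_distr[OF assms])
  also have "\<dots> = (\<Sum>i=1..m. k z (x i)) / m"
    by (subst integral_distr)
      (auto simp: measurable_cong_sets[OF sets_uniform_count_measure_count_space refl]
        integral_uniform_count_measure)
  finally show ?thesis .
qed

section \<open>Centred sums and their squared norms\<close>

definition deviation :: "'a measure \<Rightarrow> nat \<Rightarrow> (nat \<Rightarrow> 'a) \<Rightarrow> 'a \<Rightarrow> real" where
  "deviation P m x = (\<lambda>z. \<Sum>i=1..m. k z (x i) - mean_embedding H ip k P z)"

text \<open>The inner product of the centred features at \<open>y\<close> and \<open>z\<close>,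
  multiplied out into real terms: the degenerate kernel of a V-statistic.\<close>

definition centred_kernel :: "'a measure \<Rightarrow> 'a \<Rightarrow> 'a \<Rightarrow> real" where
  "centred_kernel P y z = k y z - mean_embedding H ip k P y - mean_embedding H ip k P z
     + (\<integral>x. mean_embedding H ip k P x \<partial>P)"

lemma deviation_mem:
  assumes "P \<in> borel_probs"
  shows "deviation P m x \<in> H"
  using sum_mem[of "{1..m}" "\<lambda>i z. k z (x i) - mean_embedding H ip k P z" "\<lambda>_. 1"]
  by (simp add: deviation_def diff_mem kernel_mem mean_embedding_mem[OF assms])

lemma ip_deviation:
  assumes P: "P \<in> borel_probs"
  shows "ip (deviation P m x) (deviation P m x) = (\<Sum>i=1..m. \<Sum>j=1..m. centred_kernel P (x i) (x j))"
proof -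
  let ?\<mu> = "mean_embedding H ip k P"
  define F where "F y = (\<lambda>z. k z y - ?\<mu> z)" for y
  note \<mu> = mean_embedding_mem[OF P]
  have F: "F y \<in> H" for y unfolding F_def by (intro diff_mem kernel_mem \<mu>)
  have k\<mu>: "ip (\<lambda>z. k z y) ?\<mu> = ?\<mu> y" for y
    using ip_commute[OF kernel_mem \<mu>] by (simp add: reproducing \<mu>)
  have FF: "ip (F y) (F z) = centred_kernel P y z" for y z
    using kernel_commute[of z y]
    by (simp add: F_def ip_diff_left ip_diff_right diff_mem kernel_mem \<mu> reproducing k\<mu>
        ip_mean_embedding[OF P \<mu>] centred_kernel_def)
  have dev: "deviation P m x = (\<lambda>z. \<Sum>i=1..m. 1 * F (x i) z)"
    by (simp add: deviation_def F_def)
  have left: "ip (deviation P m x) g = (\<Sum>i=1..m. ip (F (x i)) g)" if "g \<in> H" for g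
    unfolding dev by (subst ip_sum_left) (simp_all add: F that)
  have "ip (F y) (deviation P m x) = (\<Sum>j=1..m. ip (F y) (F (x j)))" for y
    using ip_commute[OF F deviation_mem[OF P]] left[OF F] ip_commute[OF F F]
    by (simp cong: sum.cong)
  then show ?thesis
    by (simp add: left deviation_mem[OF P] FF)
qed

lemma abs_deviation_le:
  assumes "P \<in> borel_probs"
  shows "\<bar>deviation P m x z\<bar> \<le> sqrt B * fnorm ip (deviation P m x)"
  using abs_mem_le[OF deviation_mem[OF assms], of m x z] by (simp add: mult.commute)

lemma abs_centred_kernel_le:
  assumes P: "P \<in> borel_probs"
  shows "\<bar>centred_kernel P y z\<bar> \<le> 4 * B"
  using abs_kernel_le[of y z] abs_mean_embedding_le[OF P, of y] abs_mean_embedding_le[OF P, of z]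
    abs_integral_le[OF P mean_embedding_mem[OF P] abs_mean_embedding_le[OF P]]
  unfolding centred_kernel_def by linarith

lemma borel_measurable_centred_kernel:
  assumes P: "P \<in> borel_probs"
  shows "(\<lambda>(y, z). centred_kernel P y z) \<in> borel_measurable (borel \<Otimes>\<^sub>M borel)"
proof -
  have [measurable]: "mean_embedding H ip k P \<in> borel_measurable borel"
    by (intro borel_measurable_mem mean_embedding_mem P)
  have [measurable]: "(\<lambda>p. k (fst p) (snd p)) \<in> borel_measurable (borel \<Otimes>\<^sub>M borel)"
    using borel_measurable_kernel_pair by (simp add: case_prod_beta')
  show ?thesis
    unfolding centred_kernel_def case_prod_beta' by measurable
qed

text \<open>Integrating \<open>k y z\<close> over \<open>z\<close> gives the mean embedding at
  \<open>y\<close>, so the four terms cancel in pairs. This is degeneracy: it holds for each fixed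
  \<open>y\<close>, not merely on average.\<close>

lemma integral_centred_kernel:
  assumes P: "P \<in> borel_probs"
  shows "(\<integral>z. centred_kernel P y z \<partial>P) = 0"
proof -
  interpret prob_space P using P by (simp add: borel_probs_def)
  show ?thesis
    unfolding centred_kernel_def
    using integrable_mem[OF P kernel_mem[of y]] integrable_mem[OF P mean_embedding_mem[OF P]]
    by (simp add: kernel_commute[of y] prob_space mean_embedding_eq[OF P, of y])
qed

section \<open>Second moments and tail bounds for an i.i.d. sample\<close>

context
  fixes P :: "'a measure" and \<Omega> :: "'w measure" and X :: "nat \<Rightarrow> 'w \<Rightarrow> 'a"
  assumes P: "P \<in> borel_probs" and iid: "iid_sample P \<Omega> X"
begin

interpretation \<Omega>: prob_space \<Omega>
  using iid by (simp add: iid_sample_def)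

lemma sample_measurable: "i \<ge> 1 \<Longrightarrow> X i \<in> \<Omega> \<rightarrow>\<^sub>M borel"
  using iid \<Omega>.indep_vars_def[of "\<lambda>_. borel" X "{1..}"] by (simp add: iid_sample_def)

lemma integrable_centred_kernel_sample:
  assumes "i \<ge> 1" "j \<ge> 1"
  shows "integrable \<Omega> (\<lambda>\<omega>. centred_kernel P (X i \<omega>) (X j \<omega>))"
proof (rule \<Omega>.integrable_const_bound)
  show "AE \<omega> in \<Omega>. norm (centred_kernel P (X i \<omega>) (X j \<omega>)) \<le> 4 * B"
    by (simp add: abs_centred_kernel_le[OF P])
  have [measurable]: "X i \<in> \<Omega> \<rightarrow>\<^sub>M borel" "X j \<in> \<Omega> \<rightarrow>\<^sub>M borel"
    using assms by (auto intro: sample_measurable)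
  show "(\<lambda>\<omega>. centred_kernel P (X i \<omega>) (X j \<omega>)) \<in> borel_measurable \<Omega>"
    using measurable_compose[OF measurable_Pair borel_measurable_centred_kernel[OF P],
        of "X i" \<Omega> "X j"] by simp
qed

text \<open>Independence makes the joint law of the two observations
  \<open>P \<Otimes>\<^sub>M P\<close>; by Fubini the inner integral can be taken first, and it
  vanishes by degeneracy.\<close>

lemma expectation_centred_kernel_sample:
  assumes "i \<ge> 1" "j \<ge> 1" "i \<noteq> j"
  shows "(\<integral>\<omega>. centred_kernel P (X i \<omega>) (X j \<omega>) \<partial>\<Omega>) = 0"
proof -
  interpret P: prob_space P using P by (simp add: borel_probs_def)
  interpret PP: pair_prob_space P P ..
  have sets_P: "sets P = sets borel" using P by (simp add: borel_probs_def)
  note meas = borel_measurable_centred_kernel[OF P]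
  have [measurable]: "X i \<in> \<Omega> \<rightarrow>\<^sub>M borel" "X j \<in> \<Omega> \<rightarrow>\<^sub>M borel"
    using assms by (auto intro: sample_measurable)
  have "\<Omega>.indep_var borel (X i) borel (X j)"
    using iid assms by (intro \<Omega>.indep_var_of_indep_vars[where I = "{1..}"]) (auto simp: iid_sample_def)
  then have joint: "distr \<Omega> (borel \<Otimes>\<^sub>M borel) (\<lambda>\<omega>. (X i \<omega>, X j \<omega>)) = P \<Otimes>\<^sub>M P"
    using iid assms by (simp add: \<Omega>.indep_var_distribution_eq iid_sample_def)
  have "(\<integral>\<omega>. centred_kernel P (X i \<omega>) (X j \<omega>) \<partial>\<Omega>) =
      (\<integral>p. (case p of (y, z) \<Rightarrow> centred_kernel P y z) \<partial>(P \<Otimes>\<^sub>M P))"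
    unfolding joint[symmetric] by (subst integral_distr[OF _ meas]) simp_all
  also have "\<dots> = (\<integral>y. (\<integral>z. centred_kernel P y z \<partial>P) \<partial>P)"
  proof (rule PP.integral_fst[symmetric])
    show "integrable (P \<Otimes>\<^sub>M P) (\<lambda>(y, z). centred_kernel P y z)"
      using meas measurable_cong_sets[OF sets_pair_measure_cong[OF sets_P sets_P] refl]
      by (intro PP.integrable_const_bound[of _ "4 * B"]) (auto simp: abs_centred_kernel_le[OF P])
  qed
  finally show ?thesis by (simp add: integral_centred_kernel[OF P])
qed

lemma integrable_ip_deviation:
  "integrable \<Omega> (\<lambda>\<omega>. ip (deviation P m (\<lambda>i. X i \<omega>)) (deviation P m (\<lambda>i. X i \<omega>)))"
  unfolding ip_deviation[OF P]
  by (intro Bochner_Integration.integrable_sum integrable_centred_kernel_sample) auto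

text \<open>Only the \<open>m\<close> diagonal terms of the double sum survive. Each is at most
  \<open>4 * B\<close>, one \<open>B\<close> for each summand of
  \<open>centred_kernel\<close>.\<close>

lemma expectation_ip_deviation_le:
  "(\<integral>\<omega>. ip (deviation P m (\<lambda>i. X i \<omega>)) (deviation P m (\<lambda>i. X i \<omega>)) \<partial>\<Omega>) \<le> 4 * B * m"
proof -
  have int: "integrable \<Omega> (\<lambda>\<omega>. centred_kernel P (X i \<omega>) (X j \<omega>))" if "i \<in> {1..m}" "j \<in> {1..m}" for i j
    using that by (intro integrable_centred_kernel_sample) auto
  have "(\<integral>\<omega>. ip (deviation P m (\<lambda>i. X i \<omega>)) (deviation P m (\<lambda>i. X i \<omega>)) \<partial>\<Omega>) =
      (\<Sum>i=1..m. \<Sum>j=1..m. \<integral>\<omega>. centred_kernel P (X i \<omega>) (X j \<omega>) \<partial>\<Omega>)"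
    unfolding ip_deviation[OF P]
    by (subst Bochner_Integration.integral_sum)
      (intro Bochner_Integration.integrable_sum sum.cong refl Bochner_Integration.integral_sum int; assumption)+
  also have "\<dots> \<le> (\<Sum>i=1..m. \<Sum>j=1..m. if j = i then 4 * B else 0)"
  proof (intro sum_mono)
    fix i j assume ij: "i \<in> {1..m}" "j \<in> {1..m}"
    have "(\<integral>\<omega>. centred_kernel P (X i \<omega>) (X i \<omega>) \<partial>\<Omega>) \<le> (\<integral>\<omega>. 4 * B \<partial>\<Omega>)"
      using abs_centred_kernel_le[OF P] abs_le_D1 by (intro integral_mono int ij) auto
    then show "(\<integral>\<omega>. centred_kernel P (X i \<omega>) (X j \<omega>) \<partial>\<Omega>) \<le> (if j = i then 4 * B else 0)"
      using expectation_centred_kernel_sample[of i j] ij by (auto simp: \<Omega>.prob_space)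
  qed
  also have "\<dots> = 4 * B * m" by simp
  finally show ?thesis .
qed

text \<open>The terms of \<open>deviation\<close> are bounded by \<open>2 * B\<close>, so a large deviation at \<open>m\<close> forces one at
  the square \<open>j\<^sup>2\<close> below \<open>m\<close>, where the second-moment bounds are summable.\<close>

lemma large_deviation_at_square:
  fixes \<epsilon> :: real
  assumes large: "\<bar>deviation P m x z\<bar> > \<epsilon> * m" and j: "j = floor_sqrt m" "8 * B \<le> \<epsilon> * j" and "\<epsilon> > 0"
  shows "(\<epsilon> / 2 * (real j)\<^sup>2)\<^sup>2 \<le> B * ip (deviation P (j\<^sup>2) x) (deviation P (j\<^sup>2) x)"
proof -
  \<comment> \<open>From \<open>m < (j + 1)^2\<close> at most \<open>2 * j\<close> summands separate
    \<open>m\<close> from the square below it.\<close>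
  have jm: "j\<^sup>2 \<le> m" and mj: "m \<le> j\<^sup>2 + 2 * j"
    using floor_sqrt_power2_le[of m] Suc_floor_sqrt_power2_gt[of m]
    by (simp_all add: j(1) power2_eq_square)
  define t where "t i = k z (x i) - mean_embedding H ip k P z" for i
  have t: "\<bar>t i\<bar> \<le> 2 * B" for i
    using abs_kernel_le[of z "x i"] abs_mean_embedding_le[OF P, of z] unfolding t_def by linarith
  have "{1..m} = {1..j\<^sup>2} \<union> {j\<^sup>2<..m}" using jm by auto
  then have "deviation P m x z = deviation P (j\<^sup>2) x z + (\<Sum>i\<in>{j\<^sup>2<..m}. t i)"
    unfolding deviation_def t_def[symmetric] by (simp only:) (rule sum.union_disjoint; auto)
  moreover have "\<bar>\<Sum>i\<in>{j\<^sup>2<..m}. t i\<bar> \<le> (\<Sum>i\<in>{j\<^sup>2<..m}. 2 * B)"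
    by (rule order.trans[OF sum_abs sum_mono[OF t]])
  moreover have "(\<Sum>i\<in>{j\<^sup>2<..m}. 2 * B) \<le> real (2 * j) * (2 * B)"
    using mj bound_nonneg by (simp del: of_nat_mult of_nat_diff add: mult_right_mono)
  moreover have "real (2 * j) * (2 * B) = 4 * B * j" by simp
  ultimately have "\<bar>deviation P (j\<^sup>2) x z\<bar> \<ge> \<epsilon> * m - 4 * B * j"
    using large by linarith
  moreover have "\<epsilon> * m \<ge> \<epsilon> * (real j)\<^sup>2"
    using jm \<open>\<epsilon> > 0\<close> by (simp flip: of_nat_power)
  \<comment> \<open>The drift \<open>4 * B * j\<close> is thus at most half of
    \<open>\<epsilon> * j^2\<close>, which leaves the factor \<open>\<epsilon> / 2\<close> in the
    conclusion.\<close>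
  moreover have "8 * B * j \<le> \<epsilon> * (real j)\<^sup>2"
    using mult_right_mono[OF j(2), of "real j"] by (simp add: power2_eq_square)
  ultimately have "\<epsilon> / 2 * (real j)\<^sup>2 \<le> \<bar>deviation P (j\<^sup>2) x z\<bar>" by simp
  also have "\<dots> \<le> sqrt B * fnorm ip (deviation P (j\<^sup>2) x)" by (rule abs_deviation_le[OF P])
  finally have "(\<epsilon> / 2 * (real j)\<^sup>2)\<^sup>2 \<le> (sqrt B * fnorm ip (deviation P (j\<^sup>2) x))\<^sup>2"
    using \<open>\<epsilon> > 0\<close> by (intro power_mono) auto
  then show ?thesis
    by (simp add: power_mult_distrib bound_nonneg fnorm_square deviation_mem[OF P])
qed

text \<open>Markov's inequality with mean at most \<open>4 * B^2 * j^2\<close> and threshold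
  \<open>\<epsilon>^2 * j^4 / 4\<close>; hence the constant 16.\<close>

lemma prob_large_deviation_at_square:
  fixes \<epsilon> :: real
  assumes "j \<ge> 1" "\<epsilon> > 0" "B > 0"
  defines "A \<equiv> {\<omega> \<in> space \<Omega>. (\<epsilon> / 2 * (real j)\<^sup>2)\<^sup>2 \<le>
      B * ip (deviation P (j\<^sup>2) (\<lambda>i. X i \<omega>)) (deviation P (j\<^sup>2) (\<lambda>i. X i \<omega>))}"
  shows "A \<in> sets \<Omega>" and "measure \<Omega> A \<le> 16 * B\<^sup>2 / \<epsilon>\<^sup>2 * (1 / real j ^ 2)"
proof -
  let ?Z = "\<lambda>\<omega>. B * ip (deviation P (j\<^sup>2) (\<lambda>i. X i \<omega>)) (deviation P (j\<^sup>2) (\<lambda>i. X i \<omega>))"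
  have int: "integrable \<Omega> ?Z" by (intro integrable_mult_right integrable_ip_deviation)
  then have [measurable]: "?Z \<in> borel_measurable \<Omega>" by (rule borel_measurable_integrable)
  show "A \<in> sets \<Omega>" unfolding A_def by measurable
  have "measure \<Omega> A \<le> (\<integral>\<omega>. ?Z \<omega> \<partial>\<Omega>) / (\<epsilon> / 2 * (real j)\<^sup>2)\<^sup>2"
    unfolding A_def using assms(1-3) int
    by (intro integral_Markov_inequality_measure[where A = "{}"])
      (auto simp: ip_nonneg[OF deviation_mem[OF P]])
  also have "(\<integral>\<omega>. ?Z \<omega> \<partial>\<Omega>) \<le> B * (4 * B * (real j)\<^sup>2)"
    using expectation_ip_deviation_le[of "j\<^sup>2"] \<open>B > 0\<close> by simp
  also have "B * (4 * B * (real j)\<^sup>2) / (\<epsilon> / 2 * (real j)\<^sup>2)\<^sup>2 = 16 * B\<^sup>2 / \<epsilon>\<^sup>2 * (1 / real j ^ 2)"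
    using assms(1-3) by (simp add: field_simps power2_eq_square)
  finally show "measure \<Omega> A \<le> 16 * B\<^sup>2 / \<epsilon>\<^sup>2 * (1 / real j ^ 2)"
    by (simp add: divide_right_mono)
qed

text \<open>A large deviation at some \<open>m \<ge> n\<close> triggers the event \<open>A j\<close>
  for \<open>j = floor_sqrt m\<close>, and \<open>j \<ge> r\<close> because
  \<open>r^2 \<le> n\<close>. A union bound over all \<open>j \<ge> r\<close> gives the tail of the
  series.\<close>

lemma prob_sup_deviation_le:
  fixes \<epsilon> :: real
  assumes "\<epsilon> > 0" "B > 0" and r: "r \<ge> 1" "8 * B \<le> \<epsilon> * r" "r\<^sup>2 \<le> n"
  shows "\<P>(\<omega> in \<Omega>. (SUP m\<in>{n..}. SUP x. ereal \<bar>mean_embedding H ip k (empirical_measure m (\<lambda>i. X i \<omega>)) x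
            - mean_embedding H ip k P x\<bar>) > ereal \<epsilon>)
         \<le> (\<Sum>i. 16 * B\<^sup>2 / \<epsilon>\<^sup>2 * (1 / real (i + r) ^ 2))" (is "measure \<Omega> ?E \<le> _")
proof -
  define A where "A j = {\<omega> \<in> space \<Omega>. (\<epsilon> / 2 * (real j)\<^sup>2)\<^sup>2 \<le>
      B * ip (deviation P (j\<^sup>2) (\<lambda>i. X i \<omega>)) (deviation P (j\<^sup>2) (\<lambda>i. X i \<omega>))}" for j :: nat
  have A: "A j \<in> sets \<Omega>" "measure \<Omega> (A j) \<le> 16 * B\<^sup>2 / \<epsilon>\<^sup>2 * (1 / real j ^ 2)" if "j \<ge> 1" for j
    using prob_large_deviation_at_square[OF that assms(1,2)] by (auto simp: A_def)
  have sub: "?E \<subseteq> (\<Union>i. A (i + r))"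
  proof
    fix \<omega> assume \<omega>: "\<omega> \<in> ?E"
    then obtain m z where m: "m \<ge> n"
      and z: "\<bar>mean_embedding H ip k (empirical_measure m (\<lambda>i. X i \<omega>)) z - mean_embedding H ip k P z\<bar> > \<epsilon>"
      by (auto simp: less_SUP_iff)
    have "r\<^sup>2 \<le> m" using m r by simp
    then have rj: "r \<le> floor_sqrt m" by (rule le_floor_sqrtI)
    have "m \<ge> 1" using \<open>r\<^sup>2 \<le> m\<close> r(1) by (metis one_le_power order.trans)
    then have "deviation P m (\<lambda>i. X i \<omega>) z = m * (mean_embedding H ip k (empirical_measure m (\<lambda>i. X i \<omega>)) z
        - mean_embedding H ip k P z)"
      by (simp add: mean_embedding_empirical_measure deviation_def sum_subtractf algebra_simps)
    then have "\<bar>deviation P m (\<lambda>i. X i \<omega>) z\<bar> > \<epsilon> * m"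
      using z \<open>m \<ge> 1\<close> by (simp add: abs_mult mult.commute)
    moreover have "8 * B \<le> \<epsilon> * floor_sqrt m"
      using r(2) rj \<open>\<epsilon> > 0\<close> by (smt (verit) mult_left_mono of_nat_mono)
    ultimately have "\<omega> \<in> A (floor_sqrt m)"
      using large_deviation_at_square[OF _ refl _ \<open>\<epsilon> > 0\<close>, of m "\<lambda>i. X i \<omega>" z] \<omega> by (simp add: A_def)
    then have "\<omega> \<in> A ((floor_sqrt m - r) + r)" using rj by simp
    then show "\<omega> \<in> (\<Union>i. A (i + r))" by blast
  qed
  have summ: "summable (\<lambda>i. 16 * B\<^sup>2 / \<epsilon>\<^sup>2 * (1 / real (i + r) ^ 2))"
    using inverse_power_summable[of 2, where 'a = real]
    by (intro summable_mult summable_ignore_initial_segment[where f = "\<lambda>i. 1 / real i ^ 2"])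
      (simp add: field_simps)
  have le: "measure \<Omega> (A (i + r)) \<le> 16 * B\<^sup>2 / \<epsilon>\<^sup>2 * (1 / real (i + r) ^ 2)" for i
    using A(2)[of "i + r"] r(1) by simp
  have summA: "summable (\<lambda>i. measure \<Omega> (A (i + r)))"
    using le by (intro summable_comparison_test'[OF summ]) auto
  have AS: "range (\<lambda>i. A (i + r)) \<subseteq> sets \<Omega>"
    using A(1) r(1) by auto
  \<comment> \<open>Monotonicity asks only that the larger set be measurable, so the supremum
    defining \<open>?E\<close> raises no measurability question.\<close>
  have "measure \<Omega> ?E \<le> measure \<Omega> (\<Union>i. A (i + r))"
    using sub AS by (intro \<Omega>.finite_measure_mono) auto
  also have "\<dots> \<le> (\<Sum>i. measure \<Omega> (A (i + r)))"
    by (rule \<Omega>.finite_measure_subadditive_countably[OF AS summA])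
  also have "\<dots> \<le> (\<Sum>i. 16 * B\<^sup>2 / \<epsilon>\<^sup>2 * (1 / real (i + r) ^ 2))"
    by (rule suminf_le[OF le summA summ])
  finally show ?thesis .
qed

end

end

section \<open>Uniformity over all Borel probability measures\<close>

theorem theorem7:
  fixes k :: "'a::topological_space \<Rightarrow> 'a \<Rightarrow> real"
    and H :: "('a \<Rightarrow> real) set"
    and ip :: "('a \<Rightarrow> real) \<Rightarrow> ('a \<Rightarrow> real) \<Rightarrow> real"
    and \<Omega> :: "'a measure \<Rightarrow> 'w measure"
    and X :: "'a measure \<Rightarrow> nat \<Rightarrow> 'w \<Rightarrow> 'a"
    and \<epsilon> :: real
  assumes "separable_space (euclidean :: 'a topology)"
    and "is_kernel k"
    and "bounded (range (\<lambda>(x, y). k x y))"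
    and "continuous_on UNIV (\<lambda>(x, y). k x y)"
    and "is_rkhs k H ip"
    and "\<And>P. P \<in> borel_probs \<Longrightarrow> iid_sample P (\<Omega> P) (X P)"
    and "\<epsilon> > 0"
  shows "(\<lambda>n. SUP P\<in>borel_probs. \<P>(\<omega> in \<Omega> P.
            (SUP m\<in>{n..}. SUP x. ereal \<bar>mean_embedding H ip k (empirical_measure m (\<lambda>i. X P i \<omega>)) x
                                     - mean_embedding H ip k P x\<bar>) > ereal \<epsilon>))
         \<longlonglongrightarrow> 0"
proof -
  obtain B where B: "B > 0" "\<And>x y. \<bar>k x y\<bar> \<le> B"
    using assms(3) by (auto simp: bounded_pos)
  interpret bounded_continuous_rkhs H ip k B
    by unfold_locales (use assms B in \<open>auto simp: is_rkhs_def\<close>)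
  let ?p = "\<lambda>n P. \<P>(\<omega> in \<Omega> P.
            (SUP m\<in>{n..}. SUP x. ereal \<bar>mean_embedding H ip k (empirical_measure m (\<lambda>i. X P i \<omega>)) x
                                     - mean_embedding H ip k P x\<bar>) > ereal \<epsilon>)"
  \<comment> \<open>A point mass shows that the index set is nonempty; suprema in the reals behave
    as such only for nonempty bounded families.\<close>
  have "return borel undefined \<in> (borel_probs :: 'a measure set)"
    by (simp add: borel_probs_def prob_space_return)
  then have ne: "(borel_probs :: 'a measure set) \<noteq> {}" by blast
  have prob: "prob_space (\<Omega> P)" if "P \<in> borel_probs" for P
    using assms(6)[OF that] by (simp add: iid_sample_def)
  have bdd: "bdd_above (?p n ` borel_probs)" for n
    by (rule bdd_aboveI[of _ 1]) (auto intro: prob_space.prob_le_1[OF prob])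
  have nonneg: "0 \<le> (SUP P\<in>borel_probs. ?p n P)" for n
    using ne by (auto intro: cSUP_upper2[OF bdd])
  \<comment> \<open>The tail depends on \<open>B\<close> and \<open>\<epsilon>\<close> but not on
    \<open>P\<close>, nor on the sample space chosen for \<open>P\<close>.\<close>
  define T where "T r = (\<Sum>i. 16 * B\<^sup>2 / \<epsilon>\<^sup>2 * (1 / real (i + r) ^ 2))" for r
  have "summable (\<lambda>i. 16 * B\<^sup>2 / \<epsilon>\<^sup>2 * (1 / real i ^ 2))"
    using inverse_power_summable[of 2, where 'a = real]
    by (intro summable_mult) (simp add: field_simps)
  then have T0: "T \<longlonglongrightarrow> 0"
    unfolding T_def by (rule suminf_exist_split2)
  obtain r0 :: nat where r0: "8 * B / \<epsilon> \<le> r0" using real_arch_simple by blast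
  show ?thesis
  proof (rule LIMSEQ_I)
    fix e :: real assume "e > 0"
    then obtain r1 where r1: "\<And>r. r \<ge> r1 \<Longrightarrow> norm (T r - 0) < e"
      using LIMSEQ_D[OF T0] by blast
    \<comment> \<open>\<open>r0\<close> makes the drift between squares harmless and
      \<open>r1\<close> makes the tail smaller than \<open>e\<close>. The threshold for
      \<open>n\<close> is \<open>r^2\<close>, since blocks are indexed by square roots.\<close>
    define r where "r = Max {1, r0, r1}"
    have r: "r \<ge> 1" "r \<ge> r0" "r \<ge> r1" by (auto simp: r_def)
    have "8 * B / \<epsilon> \<le> r" using r0 r(2) by (metis of_nat_mono order.trans)
    then have rB: "8 * B \<le> \<epsilon> * r" using assms(7) by (simp add: field_simps)
    have "norm ((SUP P\<in>borel_probs. ?p n P) - 0) < e" if "n \<ge> r\<^sup>2" for n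
    proof -
      have "(SUP P\<in>borel_probs. ?p n P) \<le> T r"
        unfolding T_def
        by (intro cSUP_least[OF ne] prob_sup_deviation_le[OF _ assms(6) assms(7) B(1) r(1) rB that])
      then show ?thesis
        using r1[OF r(3)] nonneg[of n] by simp
    qed
    then show "\<exists>N. \<forall>n\<ge>N. norm ((SUP P\<in>borel_probs. ?p n P) - 0) < e" by blast
  qed
qed

end
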